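(* Let $(L,[\,,\,]_L,\alpha,[p])$ be a restricted Hom-Lie superalgebra over $F$, let $(\Gamma,[\,,\,]_\Gamma,\beta)$ be a multiplicative Hom-Lie superalgebra over $F$, and let $\varphi:L\to\Gamma$ be a one-to-one morphism of Hom-Lie superalgebras. Then $(\varphi(L),[\,,\,]_\Gamma,\beta|_{\varphi(L)},[p]')$ is a restricted Hom-Lie superalgebra, where $$[p]':(\varphi(L))^0\to(\varphi(L))^0,\qquad \varphi(x)\mapsto\varphi(x^{[p]}).$$
   Context: $F$ is a field of characteristic $p>0$ with $p\neq 2,3$. A linear superspace is a $\mathbb{Z}_2$-graded $F$-vector space $V=V_0\oplus V_1$; $|x|$ denotes the parity of a homogeneous element $x$; a linear map $V\to V'$ is even if it maps $V_j$ into $V'_j$ for $j=0,1$, and a bilinear map is even if it respects the grading. A Hom-Lie superalgebra is a triple $(L,[\,,\,],\alpha)$ with $L$ a linear superspace, $[\,,\,]:L\times L\to L$ an even bilinear map and $\alpha:L\to L$ an even linear map such that for all homogeneous $x,y,z$: $[x,y]=-(-1)^{|x||y|}[y,x]$ and $(-1)^{|x||z|}[\alpha(x),[y,z]]+(-1)^{|z||y|}[\alpha(z),[x,y]]+(-1)^{|y||x|}[\alpha(y),[z,x]]=0$. It is multiplicative if $\alpha([x,y])=[\alpha(x),\alpha(y)]$ for all $x,y$. A morphism of Hom-Lie superalgebras $\varphi:(L,[\,,\,]_L,\alpha)\to(\Gamma,[\,,\,]_\Gamma,\beta)$ is an even linear map with $\varphi([u,v]_L)=[\varphi(u),\varphi(v)]_\Gamma$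 for all $u,v\in L$ and $\varphi\circ\alpha=\beta\circ\varphi$. For a multiplicative Hom-Lie superalgebra $L$ put $L^0=\{x\in L_0:\alpha(x)=x\}$, and for $a\in L^0$ let $\mathrm{ad}_\alpha a:L\to L$, $b\mapsto[a,\alpha(b)]$. A $p$-map for $L$ is a map $[p]:L^0\to L^0$, $x\mapsto x^{[p]}$, such that (1) $(\mathrm{ad}_\alpha x)^p=\mathrm{ad}_\alpha(x^{[p]})$ on $L$ for all $x\in L^0$; (2) $(kx)^{[p]}=k^px^{[p]}$ for all $k\in F$, $x\in L^0$; (3) $(x+y)^{[p]}=x^{[p]}+y^{[p]}+\sum_{i=1}^{p-1}s_i(x,y)$ for all $x,y\in L^0$, where $i\,s_i(x,y)$ is the coefficient of $\lambda^{i-1}$ in $(\mathrm{ad}_\alpha(\lambda x+y))^{p-1}(x)$. A restricted Hom-Lie superalgebra $(L,[\,,\,],\alpha,[p])$ is a multiplicative Hom-Lie superalgebra together with a $p$-map. The same notation is used for $\varphi(L)$ with twisting map $\beta|_{\varphi(L)}$, so $(\varphi(L))^0=\{y\in\varphi(L)\cap\Gamma_0:\beta(y)=y\}$. *)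

theory Defs
  imports
    "HOL-Library.Z2"
    "HOL-Library.FuncSet"
    "HOL-Computational_Algebra.Computational_Algebra"
begin

text \<open>
  Superspaces are given by a carrier \<open>V\<close> inside an ambient vector space (which may be all of its
  type), so that the image of a morphism is again such an object. A grading is a family \<open>G\<close> indexed
  by \<^typ>\<open>bit\<close>, the integers modulo 2; \<open>x \<in> G i\<close> says that \<open>x\<close> is homogeneous of parity \<open>i\<close>
  (zero has both parities). Operations are only constrained on the carrier.
\<close>

locale linear_superspace = vector_space scale
  for scale :: "'f::field \<Rightarrow> 'v::ab_group_add \<Rightarrow> 'v" (infixr \<open>*s\<close> 75) +
  fixes V :: "'v set" and G :: "bit \<Rightarrow> 'v set"
  assumes subspace_homogeneous: "subspace (G i)"
    and carrier_eq: "V = {u + v | u v. u \<in> G 0 \<and> v \<in> G 1}"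
    and homogeneous_disjoint: "G 0 \<inter> G 1 = {0}"

definition even_linear_map ::
  "('f \<Rightarrow> 'v \<Rightarrow> 'v) \<Rightarrow> 'v::ab_group_add set \<Rightarrow> (bit \<Rightarrow> 'v set) \<Rightarrow>
   ('f \<Rightarrow> 'w \<Rightarrow> 'w) \<Rightarrow> (bit \<Rightarrow> 'w::ab_group_add set) \<Rightarrow> ('v \<Rightarrow> 'w) \<Rightarrow> bool" where
  "even_linear_map s V G s' G' f \<longleftrightarrow>
     (\<forall>x\<in>V. \<forall>y\<in>V. f (x + y) = f x + f y) \<and>
     (\<forall>k. \<forall>x\<in>V. f (s k x) = s' k (f x)) \<and>
     (\<forall>j. \<forall>x\<in>G j. f x \<in> G' j)"

definition even_bilinear_map ::
  "('f \<Rightarrow> 'v \<Rightarrow> 'v) \<Rightarrow> 'v::ab_group_add set \<Rightarrow> (bit \<Rightarrow> 'v set) \<Rightarrow> ('v \<Rightarrow> 'v \<Rightarrow> 'v) \<Rightarrow> bool" where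
  "even_bilinear_map s V G b \<longleftrightarrow>
     (\<forall>x\<in>V. \<forall>y\<in>V. \<forall>z\<in>V. b (x + y) z = b x z + b y z \<and> b x (y + z) = b x y + b x z) \<and>
     (\<forall>k. \<forall>x\<in>V. \<forall>y\<in>V. b (s k x) y = s k (b x y) \<and> b x (s k y) = s k (b x y)) \<and>
     (\<forall>i j. \<forall>x\<in>G i. \<forall>y\<in>G j. b x y \<in> G (i + j))"

text \<open>The sign \<open>(-1)\<^sup>i\<^sup>j\<close> for parities \<open>i\<close> and \<open>j\<close>.\<close>

definition super_sign :: "bit \<Rightarrow> bit \<Rightarrow> 'f::field" where
  "super_sign i j = (if i = 1 \<and> j = 1 then - 1 else 1)"

locale hom_lie_superalgebra = linear_superspace scale V G
  for scale :: "'f::field \<Rightarrow> 'v::ab_group_add \<Rightarrow> 'v" (infixr \<open>*s\<close> 75)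
    and V :: "'v set" and G :: "bit \<Rightarrow> 'v set" +
  fixes br :: "'v \<Rightarrow> 'v \<Rightarrow> 'v" and \<alpha> :: "'v \<Rightarrow> 'v"
  assumes even_bilinear_bracket: "even_bilinear_map (*s) V G br"
    and even_linear_twist: "even_linear_map (*s) V G (*s) G \<alpha>"
    and super_skew_symmetric:
      "x \<in> G i \<Longrightarrow> y \<in> G j \<Longrightarrow> br x y = - (super_sign i j *s br y x)"
    and hom_super_jacobi:
      "x \<in> G i \<Longrightarrow> y \<in> G j \<Longrightarrow> z \<in> G k \<Longrightarrow>
         super_sign i k *s br (\<alpha> x) (br y z)
       + super_sign k j *s br (\<alpha> z) (br x y)
       + super_sign j i *s br (\<alpha> y) (br z x) = 0"

locale multiplicative_hom_lie_superalgebra = hom_lie_superalgebra +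
  assumes multiplicative: "x \<in> V \<Longrightarrow> y \<in> V \<Longrightarrow> \<alpha> (br x y) = br (\<alpha> x) (\<alpha> y)"

locale hom_lie_superalgebra_morphism =
  L: hom_lie_superalgebra scaleL L GL brL \<alpha> +
  M: hom_lie_superalgebra scaleM M GM brM \<beta>
  for scaleL :: "'f::field \<Rightarrow> 'v::ab_group_add \<Rightarrow> 'v" and L GL brL \<alpha>
    and scaleM :: "'f \<Rightarrow> 'w::ab_group_add \<Rightarrow> 'w" and M GM brM \<beta> +
  fixes \<phi> :: "'v \<Rightarrow> 'w"
  assumes even_linear: "even_linear_map scaleL L GL scaleM GM \<phi>"
    and bracket: "u \<in> L \<Longrightarrow> v \<in> L \<Longrightarrow> \<phi> (brL u v) = brM (\<phi> u) (\<phi> v)"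
    and twist: "u \<in> L \<Longrightarrow> \<phi> (\<alpha> u) = \<beta> (\<phi> u)"

text \<open>The set \<open>L\<^sup>0\<close> of even fixed points of the twisting map.\<close>

definition even_fixed :: "(bit \<Rightarrow> 'v set) \<Rightarrow> ('v \<Rightarrow> 'v) \<Rightarrow> 'v set" where
  "even_fixed G \<alpha> = {x \<in> G 0. \<alpha> x = x}"

definition ad_twist :: "('v \<Rightarrow> 'v \<Rightarrow> 'v) \<Rightarrow> ('v \<Rightarrow> 'v) \<Rightarrow> 'v \<Rightarrow> 'v \<Rightarrow> 'v" where
  "ad_twist br \<alpha> a b = br a (\<alpha> b)"

text \<open>
  To speak of coefficients of powers of \<open>\<lambda>\<close> as formal expressions (the field may be finite), work
  in \<open>L[\<lambda>]\<close>, the polynomials with coefficients in \<open>L\<close>: the bracket extends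
  \<open>\<lambda>\<close>-bilinearly, \<open>\<alpha>\<close> extends coefficientwise, and \<open>\<lambda>x + y\<close> is \<open>[:y, x:]\<close>.
\<close>

definition poly_bracket ::
  "('v \<Rightarrow> 'v \<Rightarrow> 'v) \<Rightarrow> 'v::ab_group_add poly \<Rightarrow> 'v poly \<Rightarrow> 'v poly" where
  "poly_bracket br f g =
     (\<Sum>i\<le>degree f. \<Sum>j\<le>degree g. monom (br (coeff f i) (coeff g j)) (i + j))"

text \<open>
  \<open>i s\<^sub>i(x, y)\<close> is the coefficient of \<open>\<lambda>\<^sup>i\<^sup>-\<^sup>1\<close> in \<open>(ad (\<lambda>x + y))\<^sup>p\<^sup>-\<^sup>1(x)\<close>. For \<open>0 < i < p\<close>, where it is used,
  \<open>i\<close> is invertible in the field.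
\<close>

definition jacobson_term ::
  "('f::field \<Rightarrow> 'v::ab_group_add \<Rightarrow> 'v) \<Rightarrow> ('v \<Rightarrow> 'v \<Rightarrow> 'v) \<Rightarrow> ('v \<Rightarrow> 'v) \<Rightarrow> nat \<Rightarrow> 'v \<Rightarrow> 'v \<Rightarrow> 'v"
  where
  "jacobson_term s br \<alpha> i x y =
     s (inverse (of_nat i))
       (coeff ((ad_twist (poly_bracket br) (map_poly \<alpha>) [:y, x:] ^^ (CHAR('f) - 1)) [:x:]) (i - 1))"

locale restricted_hom_lie_superalgebra = multiplicative_hom_lie_superalgebra scale V G br \<alpha>
  for scale :: "'f::field \<Rightarrow> 'v::ab_group_add \<Rightarrow> 'v" (infixr \<open>*s\<close> 75)
    and V :: "'v set" and G :: "bit \<Rightarrow> 'v set"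
    and br :: "'v \<Rightarrow> 'v \<Rightarrow> 'v" and \<alpha> :: "'v \<Rightarrow> 'v" +
  fixes pmap :: "'v \<Rightarrow> 'v"
  assumes pmap_closed: "x \<in> even_fixed G \<alpha> \<Longrightarrow> pmap x \<in> even_fixed G \<alpha>"
    and pmap_ad:
      "x \<in> even_fixed G \<alpha> \<Longrightarrow> b \<in> V \<Longrightarrow>
         (ad_twist br \<alpha> x ^^ CHAR('f)) b = ad_twist br \<alpha> (pmap x) b"
    and pmap_scale: "x \<in> even_fixed G \<alpha> \<Longrightarrow> pmap (k *s x) = k ^ CHAR('f) *s pmap x"
    and pmap_add:
      "x \<in> even_fixed G \<alpha> \<Longrightarrow> y \<in> even_fixed G \<alpha> \<Longrightarrow>
         pmap (x + y) = pmap x + pmap y + (\<Sum>i = 1..CHAR('f) - 1. jacobson_term (*s) br \<alpha> i x y)"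

text \<open>The map \<open>\<phi>(x) \<mapsto> \<phi>(x\<^sup>[\<^sup>p\<^sup>])\<close> on \<open>D \<subseteq> \<phi>(L)\<close>, for \<open>\<phi>\<close> injective on \<open>L\<close>.\<close>

definition image_pmap :: "'v set \<Rightarrow> ('v \<Rightarrow> 'w) \<Rightarrow> ('v \<Rightarrow> 'v) \<Rightarrow> 'w set \<Rightarrow> 'w \<Rightarrow> 'w" where
  "image_pmap L \<phi> pmap D = (\<lambda>y\<in>D. \<phi> (pmap (the_inv_into L \<phi> y)))"

end

theory Submission
  imports Defs
begin

text \<open>An injective morphism identifies L with its image, so the theorem is transport of
  structure along \<phi>; the work lies in checking that every ingredient is really transported.

  The image is a graded subspace of \<Gamma>, closed under bracket and twist because L is, and the
  identities hold on it because they hold in \<Gamma> (\<open>image_hom_lie_superalgebra\<close>).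
  Uniqueness of homogeneous decompositions in \<Gamma> shows that the homogeneous parts of the image
  are the images of those of L (\<open>image_homogeneous\<close>). As \<phi> intertwines the twists
  and is injective, \<phi>(x) is fixed exactly when x is, so the even fixed points of the image are
  the images of those of L (\<open>image_even_fixed\<close>). Hence the new p-map is defined on all
  of its domain.

  Each p-map axiom is then the image under \<phi> of the same axiom in L. For the first this needs
  \<phi> to commute with powers of the twisted adjoint map (\<open>map_ad_twist_funpow\<close>). For
  additivity the same is needed in polynomials over L: applied coefficientwise, \<phi> intertwines
  the formal adjoint maps (\<open>map_poly_ad_twist_funpow\<close>), so it carries Jacobson terms to
  Jacobson terms (\<open>map_jacobson_term\<close>). All laws hold on carriers only, which is why
  closure lemmas accompany every computation.\<close>

context linear_superspace
begin

lemma subspace_carrier: "subspace V"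
  unfolding carrier_eq by (intro subspace_sums subspace_homogeneous)

lemma homogeneous_subset_carrier: "G i \<subseteq> V"
proof
  fix x assume x: "x \<in> G i"
  have "0 \<in> G j" for j
    by (rule subspace_0[OF subspace_homogeneous])
  then show "x \<in> V"
    using x unfolding carrier_eq
    by (cases i) (auto intro: exI[of _ x] exI[of _ 0])
qed

lemma carrier_cases:
  assumes "x \<in> V"
  obtains u v where "x = u + v" "u \<in> G 0" "v \<in> G 1"
  using assms unfolding carrier_eq by blast

end

section \<open>Closure of the carrier and of the even fixed points under the operations\<close>

context hom_lie_superalgebra
begin

lemma bracket_homogeneous: "x \<in> G i \<Longrightarrow> y \<in> G j \<Longrightarrow> br x y \<in> G (i + j)"
  using even_bilinear_bracket by (auto simp: even_bilinear_map_def)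

lemma bracket_add:
  assumes "x \<in> V" "y \<in> V" "z \<in> V"
  shows "br (x + y) z = br x z + br y z" "br x (y + z) = br x y + br x z"
  using assms even_bilinear_bracket by (auto simp: even_bilinear_map_def)

lemma bracket_scale:
  assumes "x \<in> V" "y \<in> V"
  shows "br (k *s x) y = k *s br x y" "br x (k *s y) = k *s br x y"
  using assms even_bilinear_bracket by (auto simp: even_bilinear_map_def)

text \<open>The grading condition speaks of homogeneous arguments only; splitting both arguments
  leaves four homogeneous brackets, each in the carrier.\<close>

lemma bracket_closed:
  assumes "x \<in> V" "y \<in> V"
  shows "br x y \<in> V"
proof -
  obtain a b where x: "x = a + b" "a \<in> G 0" "b \<in> G 1"
    using assms(1) by (rule carrier_cases)
  obtain c d where y: "y = c + d" "c \<in> G 0" "d \<in> G 1"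
    using assms(2) by (rule carrier_cases)
  have abcd: "a \<in> V" "b \<in> V" "c \<in> V" "d \<in> V"
    using x y homogeneous_subset_carrier by blast+
  have hom: "br u v \<in> V" if "u \<in> G i" "v \<in> G j" for u v i j
    using bracket_homogeneous[OF that] homogeneous_subset_carrier by blast
  have "br x y = (br a c + br a d) + (br b c + br b d)"
    using abcd assms(2) unfolding x(1) y(1) by (simp add: bracket_add)
  also have "\<dots> \<in> V"
    using hom x y by (intro subspace_add[OF subspace_carrier]) blast+
  finally show ?thesis .
qed

lemma twist_homogeneous: "x \<in> G i \<Longrightarrow> \<alpha> x \<in> G i"
  using even_linear_twist by (auto simp: even_linear_map_def)

lemma twist_add: "x \<in> V \<Longrightarrow> y \<in> V \<Longrightarrow> \<alpha> (x + y) = \<alpha> x + \<alpha> y"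
  using even_linear_twist by (auto simp: even_linear_map_def)

lemma twist_scale: "x \<in> V \<Longrightarrow> \<alpha> (k *s x) = k *s \<alpha> x"
  using even_linear_twist by (auto simp: even_linear_map_def)

lemma twist_zero: "\<alpha> 0 = 0"
  using twist_add[of 0 0] subspace_0[OF subspace_carrier] by simp

lemma twist_closed:
  assumes "x \<in> V"
  shows "\<alpha> x \<in> V"
proof -
  obtain a b where x: "x = a + b" "a \<in> G 0" "b \<in> G 1"
    using assms by (rule carrier_cases)
  have ab: "a \<in> V" "b \<in> V" "\<alpha> a \<in> V" "\<alpha> b \<in> V"
    using x twist_homogeneous homogeneous_subset_carrier by blast+
  then show ?thesis
    unfolding x(1) by (simp add: twist_add subspace_add[OF subspace_carrier])
qed

lemma ad_twist_closed: "a \<in> V \<Longrightarrow> b \<in> V \<Longrightarrow> ad_twist br \<alpha> a b \<in> V"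
  unfolding ad_twist_def by (intro bracket_closed twist_closed)

text \<open>Polynomials may have coefficients anywhere in the ambient type. This lemma and the next
  keep the coefficients of iterated adjoints in the carrier, where the laws of a morphism are
  available.\<close>

lemma coeff_poly_bracket_closed:
  assumes f: "\<And>i. coeff f i \<in> V" and g: "\<And>i. coeff g i \<in> V"
  shows "coeff (poly_bracket br f g) n \<in> V"
  unfolding poly_bracket_def coeff_sum coeff_monom
  by (intro subspace_sum[OF subspace_carrier])
    (simp add: bracket_closed f g subspace_0[OF subspace_carrier])

lemma coeff_poly_ad_twist_closed:
  assumes "\<And>i. coeff f i \<in> V" and "\<And>i. coeff g i \<in> V"
  shows "coeff (ad_twist (poly_bracket br) (map_poly \<alpha>) f g) n \<in> V"
  unfolding ad_twist_def
  by (intro coeff_poly_bracket_closed)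
    (simp_all add: assms coeff_map_poly twist_zero twist_closed)

lemma even_fixed_subset_carrier: "even_fixed G \<alpha> \<subseteq> V"
  using homogeneous_subset_carrier by (auto simp: even_fixed_def)

lemma even_fixed_add: "x \<in> even_fixed G \<alpha> \<Longrightarrow> y \<in> even_fixed G \<alpha> \<Longrightarrow> x + y \<in> even_fixed G \<alpha>"
  using homogeneous_subset_carrier[of 0] subspace_add[OF subspace_homogeneous]
  by (auto simp: even_fixed_def twist_add subset_iff)

lemma even_fixed_scale: "x \<in> even_fixed G \<alpha> \<Longrightarrow> k *s x \<in> even_fixed G \<alpha>"
  using homogeneous_subset_carrier[of 0] subspace_scale[OF subspace_homogeneous]
  by (auto simp: even_fixed_def twist_scale subset_iff)

end

section \<open>The image of a morphism, its grading and its even fixed points\<close>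

context hom_lie_superalgebra_morphism
begin

lemma map_add: "x \<in> L \<Longrightarrow> y \<in> L \<Longrightarrow> \<phi> (x + y) = \<phi> x + \<phi> y"
  using even_linear by (auto simp: even_linear_map_def)

lemma map_scale: "x \<in> L \<Longrightarrow> \<phi> (scaleL k x) = scaleM k (\<phi> x)"
  using even_linear by (auto simp: even_linear_map_def)

lemma map_homogeneous: "x \<in> GL i \<Longrightarrow> \<phi> x \<in> GM i"
  using even_linear by (auto simp: even_linear_map_def)

lemma map_zero: "\<phi> 0 = 0"
  using map_add[of 0 0] L.subspace_0[OF L.subspace_carrier] by simp

lemma map_sum:
  assumes "\<And>i. i \<in> I \<Longrightarrow> f i \<in> L"
  shows "\<phi> (\<Sum>i\<in>I. f i) = (\<Sum>i\<in>I. \<phi> (f i))"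
  using assms
proof (induction I rule: infinite_finite_induct)
  case (insert j I)
  then show ?case
    by (simp add: map_add L.subspace_sum[OF L.subspace_carrier])
qed (simp_all add: map_zero)

lemma image_subset: "\<phi> ` L \<subseteq> M"
proof (rule image_subsetI)
  fix x assume "x \<in> L"
  then obtain a b where x: "x = a + b" "a \<in> GL 0" "b \<in> GL 1"
    by (rule L.carrier_cases)
  have ab: "a \<in> L" "b \<in> L" "\<phi> a \<in> M" "\<phi> b \<in> M"
    using x L.homogeneous_subset_carrier M.homogeneous_subset_carrier map_homogeneous by blast+
  then show "\<phi> x \<in> M"
    unfolding x(1) by (simp add: map_add M.subspace_add[OF M.subspace_carrier])
qed

lemma subspace_image: "M.subspace (\<phi> ` L)"
proof (rule M.subspaceI)
  show "0 \<in> \<phi> ` L"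
    using map_zero L.subspace_0[OF L.subspace_carrier] by (metis imageI)
  show "x + y \<in> \<phi> ` L" if "x \<in> \<phi> ` L" "y \<in> \<phi> ` L" for x y
    using that L.subspace_add[OF L.subspace_carrier] by (auto simp flip: map_add)
  show "scaleM c x \<in> \<phi> ` L" if "x \<in> \<phi> ` L" for x c
    using that L.subspace_scale[OF L.subspace_carrier] by (auto simp flip: map_scale)
qed

lemma map_eq_zero:
  assumes "inj_on \<phi> L" "x \<in> L"
  shows "\<phi> x = 0 \<longleftrightarrow> x = 0"
  using inj_on_eq_iff[OF assms(1,2), of 0] L.subspace_0[OF L.subspace_carrier] map_zero by simp

text \<open>If \<phi>(a + b) has parity j, with a even and b odd, then the image of the component of
  the other parity lies in both homogeneous parts of \<Gamma>, hence vanishes. So \<phi>(a + b) is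
  already the image of the component of parity j.\<close>

lemma image_homogeneous:
  assumes inj: "inj_on \<phi> L"
  shows "\<phi> ` GL j = \<phi> ` L \<inter> GM j"
proof
  show "\<phi> ` GL j \<subseteq> \<phi> ` L \<inter> GM j"
    using L.homogeneous_subset_carrier map_homogeneous by blast
  show "\<phi> ` L \<inter> GM j \<subseteq> \<phi> ` GL j"
  proof
    fix y assume "y \<in> \<phi> ` L \<inter> GM j"
    then obtain x where x: "y = \<phi> x" "x \<in> L" "\<phi> x \<in> GM j"
      by blast
    obtain a b where ab: "x = a + b" "a \<in> GL 0" "b \<in> GL 1"
      using x(2) by (rule L.carrier_cases)
    have abL: "a \<in> L" "b \<in> L"
      using ab L.homogeneous_subset_carrier by blast+
    have sum: "\<phi> x = \<phi> a + \<phi> b"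
      using abL by (simp add: ab(1) map_add)
    have hom: "\<phi> a \<in> GM 0" "\<phi> b \<in> GM 1"
      using ab map_homogeneous by blast+
    show "y \<in> \<phi> ` GL j"
    proof (cases "j = 0")
      case True
      have "\<phi> x - \<phi> a \<in> GM 0"
        using x(3) hom True by (intro M.subspace_diff[OF M.subspace_homogeneous]) auto
      then have "\<phi> b = 0"
        using hom M.homogeneous_disjoint by (auto simp: sum)
      then show ?thesis
        using x(1) ab(2) True by (simp add: sum)
    next
      case False
      have "\<phi> x - \<phi> b \<in> GM 1"
        using x(3) hom False by (intro M.subspace_diff[OF M.subspace_homogeneous]) auto
      then have "\<phi> a = 0"
        using hom M.homogeneous_disjoint by (auto simp: sum)
      then show ?thesis
        using x(1) ab(3) False by (simp add: sum)
    qed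
  qed
qed

text \<open>Applying \<phi> to \<alpha> x = x gives one direction; injectivity cancels \<phi> in the
  other. This is what makes the transported p-map defined everywhere it should be.\<close>

lemma image_even_fixed:
  assumes inj: "inj_on \<phi> L"
  shows "\<phi> ` even_fixed GL \<alpha> = even_fixed (\<lambda>j. \<phi> ` L \<inter> GM j) (restrict \<beta> (\<phi> ` L))"
proof -
  have "\<alpha> x = x \<longleftrightarrow> \<beta> (\<phi> x) = \<phi> x" if "x \<in> GL 0" for x
  proof -
    have "x \<in> L"
      using that L.homogeneous_subset_carrier by blast
    then show ?thesis
      using inj_on_eq_iff[OF inj L.twist_closed] twist by metis
  qed
  then show ?thesis
    using L.homogeneous_subset_carrier[of 0]
    unfolding even_fixed_def image_homogeneous[OF inj, symmetric]
    by (auto simp: subset_iff)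
qed

section \<open>Transport of twisted adjoint maps and Jacobson terms\<close>

lemma restricted_twist: "u \<in> L \<Longrightarrow> restrict \<beta> (\<phi> ` L) (\<phi> u) = \<phi> (\<alpha> u)"
  by (simp add: twist)

text \<open>\<open>map_poly\<close> acts coefficientwise only for functions that send 0 to 0, and
  \<open>restrict\<close> gives this because 0 lies in the image.\<close>

lemma restricted_twist_zero: "restrict \<beta> (\<phi> ` L) 0 = 0"
  using restricted_twist[of 0] L.subspace_0[OF L.subspace_carrier]
  by (simp add: map_zero L.twist_zero)

text \<open>
  Injectivity makes \<open>\<phi>\<close> preserve the degree, hence the ranges of summation in
  \<^const>\<open>poly_bracket\<close>.
\<close>

lemma map_poly_bracket:
  assumes inj: "inj_on \<phi> L"
    and f: "\<And>i. coeff f i \<in> L" and g: "\<And>i. coeff g i \<in> L"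
  shows "map_poly \<phi> (poly_bracket brL f g) = poly_bracket brM (map_poly \<phi> f) (map_poly \<phi> g)"
proof -
  have deg: "degree (map_poly \<phi> h) = degree h" if "\<And>i. coeff h i \<in> L" for h
    using that map_eq_zero[OF inj] by (cases "h = 0") (simp_all add: map_poly_degree_eq)
  \<comment> \<open>This conditional is the n-th coefficient of one monomial of the bracket; moving
    \<phi> inside the double sum requires every such term, including 0, to lie in L.\<close>
  have closed: "(if i + j = n then brL (coeff f i) (coeff g j) else 0) \<in> L" for i j n
    by (simp add: f g L.bracket_closed L.subspace_0[OF L.subspace_carrier])
  show ?thesis
  proof (rule poly_eqI)
    fix n
    show "coeff (map_poly \<phi> (poly_bracket brL f g)) n
        = coeff (poly_bracket brM (map_poly \<phi> f) (map_poly \<phi> g)) n"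
      unfolding poly_bracket_def deg[OF f] deg[OF g]
      by (simp only: coeff_map_poly[where f = \<phi>, OF map_zero] coeff_sum map_sum closed
          L.subspace_sum[OF L.subspace_carrier] coeff_monom bracket[OF f g, symmetric]
          if_distrib[of \<phi>] map_zero)
  qed
qed

lemma map_poly_ad_twist:
  assumes inj: "inj_on \<phi> L"
    and f: "\<And>i. coeff f i \<in> L" and g: "\<And>i. coeff g i \<in> L"
  shows "map_poly \<phi> (ad_twist (poly_bracket brL) (map_poly \<alpha>) f g)
       = ad_twist (poly_bracket brM) (map_poly (restrict \<beta> (\<phi> ` L))) (map_poly \<phi> f) (map_poly \<phi> g)"
proof -
  have "coeff (map_poly \<alpha> g) i \<in> L" for i
    by (simp add: coeff_map_poly L.twist_zero L.twist_closed g)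
  moreover have "map_poly \<phi> (map_poly \<alpha> g) = map_poly (restrict \<beta> (\<phi> ` L)) (map_poly \<phi> g)"
    by (rule poly_eqI)
      (simp add: coeff_map_poly L.twist_zero map_zero restricted_twist_zero restricted_twist g
        del: restrict_apply)
  ultimately show ?thesis
    unfolding ad_twist_def by (simp add: map_poly_bracket[OF inj f])
qed

text \<open>Both claims go through one induction: intertwining the next application requires the
  coefficients of the current iterate to lie in L.\<close>

lemma map_poly_ad_twist_funpow:
  assumes inj: "inj_on \<phi> L"
    and f: "\<And>i. coeff f i \<in> L" and g: "\<And>i. coeff g i \<in> L"
  shows "map_poly \<phi> ((ad_twist (poly_bracket brL) (map_poly \<alpha>) f ^^ n) g)
       = (ad_twist (poly_bracket brM) (map_poly (restrict \<beta> (\<phi> ` L))) (map_poly \<phi> f) ^^ n)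
           (map_poly \<phi> g)"
    and "coeff ((ad_twist (poly_bracket brL) (map_poly \<alpha>) f ^^ n) g) i \<in> L"
proof (induction n arbitrary: i)
  case 0
  show "map_poly \<phi> ((ad_twist (poly_bracket brL) (map_poly \<alpha>) f ^^ 0) g)
       = (ad_twist (poly_bracket brM) (map_poly (restrict \<beta> (\<phi> ` L))) (map_poly \<phi> f) ^^ 0)
           (map_poly \<phi> g)"
    and "coeff ((ad_twist (poly_bracket brL) (map_poly \<alpha>) f ^^ 0) g) i \<in> L" for i
    by (simp_all add: g)
next
  case (Suc n)
  show "map_poly \<phi> ((ad_twist (poly_bracket brL) (map_poly \<alpha>) f ^^ Suc n) g)
       = (ad_twist (poly_bracket brM) (map_poly (restrict \<beta> (\<phi> ` L))) (map_poly \<phi> f) ^^ Suc n)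
           (map_poly \<phi> g)"
    using map_poly_ad_twist[OF inj f Suc(2)] Suc(1) by (simp del: restrict_apply)
  show "coeff ((ad_twist (poly_bracket brL) (map_poly \<alpha>) f ^^ Suc n) g) i \<in> L" for i
    using L.coeff_poly_ad_twist_closed[OF f Suc(2)] by simp
qed

text \<open>Both algebras are over the same field, so the exponent p - 1 and the scalar 1/i agree on
  the two sides; the rest is that \<phi> commutes with the formal adjoint powers and with taking a
  coefficient.\<close>

lemma
  assumes inj: "inj_on \<phi> L" and xy: "x \<in> L" "y \<in> L"
  shows map_jacobson_term: "\<phi> (jacobson_term scaleL brL \<alpha> i x y)
        = jacobson_term scaleM brM (restrict \<beta> (\<phi> ` L)) i (\<phi> x) (\<phi> y)" (is ?map)
    and jacobson_term_closed: "jacobson_term scaleL brL \<alpha> i x y \<in> L" (is ?closed)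
proof -
  have zero: "0 \<in> L"
    by (rule L.subspace_0[OF L.subspace_carrier])
  have f: "coeff [:y, x:] j \<in> L" and g: "coeff [:x:] j \<in> L" for j
    using xy zero by (simp_all add: coeff_pCons split: nat.splits)
  have "map_poly \<phi> [:y, x:] = [:\<phi> y, \<phi> x:]" "map_poly \<phi> [:x:] = [:\<phi> x:]"
    by (auto intro!: poly_eqI simp: coeff_map_poly map_zero coeff_pCons split: nat.splits)
  then show ?map
    using map_poly_ad_twist_funpow(1)[OF inj f g, of "CHAR('f) - 1", symmetric]
    by (simp add: jacobson_term_def coeff_map_poly map_zero map_scale
        map_poly_ad_twist_funpow(2)[OF inj f g])
  show ?closed
    unfolding jacobson_term_def
    by (intro L.subspace_scale[OF L.subspace_carrier] map_poly_ad_twist_funpow(2)[OF inj f g])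
qed

lemma map_ad_twist:
  assumes "a \<in> L" "b \<in> L"
  shows "\<phi> (ad_twist brL \<alpha> a b) = ad_twist brM (restrict \<beta> (\<phi> ` L)) (\<phi> a) (\<phi> b)"
  using assms by (simp add: ad_twist_def bracket L.twist_closed twist)

lemma map_ad_twist_funpow:
  assumes "a \<in> L" "b \<in> L"
  shows "\<phi> ((ad_twist brL \<alpha> a ^^ n) b) = (ad_twist brM (restrict \<beta> (\<phi> ` L)) (\<phi> a) ^^ n) (\<phi> b)"
    and "(ad_twist brL \<alpha> a ^^ n) b \<in> L"
proof (induction n)
  case (Suc n)
  show "\<phi> ((ad_twist brL \<alpha> a ^^ Suc n) b)
      = (ad_twist brM (restrict \<beta> (\<phi> ` L)) (\<phi> a) ^^ Suc n) (\<phi> b)"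
    using Suc assms(1) by (simp add: map_ad_twist del: restrict_apply)
  show "(ad_twist brL \<alpha> a ^^ Suc n) b \<in> L"
    using Suc(2) assms(1) by (simp add: L.ad_twist_closed)
qed (simp_all add: assms)

section \<open>The Hom-Lie superalgebra structure on the image\<close>

text \<open>Skew-symmetry and the Jacobi identity are inherited from \<Gamma>, since the restricted
  twist agrees with \<beta> on the image. The homogeneous decomposition and closure come from L by
  applying \<phi>.\<close>

lemma image_hom_lie_superalgebra:
  assumes inj: "inj_on \<phi> L"
  shows "hom_lie_superalgebra scaleM (\<phi> ` L) (\<lambda>j. \<phi> ` L \<inter> GM j) brM (restrict \<beta> (\<phi> ` L))"
proof unfold_locales
  show "M.subspace (\<phi> ` L \<inter> GM i)" for i
    by (intro M.subspace_inter subspace_image M.subspace_homogeneous)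
  show "\<phi> ` L = {u + v |u v. u \<in> \<phi> ` L \<inter> GM 0 \<and> v \<in> \<phi> ` L \<inter> GM 1}"
  proof
    show "\<phi> ` L \<subseteq> {u + v |u v. u \<in> \<phi> ` L \<inter> GM 0 \<and> v \<in> \<phi> ` L \<inter> GM 1}"
    proof (rule image_subsetI)
      fix x assume "x \<in> L"
      then obtain a b where x: "x = a + b" "a \<in> GL 0" "b \<in> GL 1"
        by (rule L.carrier_cases)
      then have "\<phi> x = \<phi> a + \<phi> b"
        using L.homogeneous_subset_carrier by (auto intro!: map_add)
      then show "\<phi> x \<in> {u + v |u v. u \<in> \<phi> ` L \<inter> GM 0 \<and> v \<in> \<phi> ` L \<inter> GM 1}"
        using x(2,3) unfolding image_homogeneous[OF inj, symmetric] by blast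
    qed
    show "{u + v |u v. u \<in> \<phi> ` L \<inter> GM 0 \<and> v \<in> \<phi> ` L \<inter> GM 1} \<subseteq> \<phi> ` L"
      using M.subspace_add[OF subspace_image] by blast
  qed
  show "(\<phi> ` L \<inter> GM 0) \<inter> (\<phi> ` L \<inter> GM 1) = {0}"
    using M.homogeneous_disjoint M.subspace_0[OF subspace_image] by blast
  have brM_closed: "brM x y \<in> \<phi> ` L" if "x \<in> \<phi> ` L" "y \<in> \<phi> ` L" for x y
    using that L.bracket_closed by (auto simp flip: bracket)
  show "even_bilinear_map scaleM (\<phi> ` L) (\<lambda>j. \<phi> ` L \<inter> GM j) brM"
    unfolding even_bilinear_map_def
    using brM_closed image_subset M.bracket_add M.bracket_scale M.bracket_homogeneous
    by (simp add: subset_iff)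
  show "even_linear_map scaleM (\<phi> ` L) (\<lambda>j. \<phi> ` L \<inter> GM j) scaleM (\<lambda>j. \<phi> ` L \<inter> GM j)
     (restrict \<beta> (\<phi> ` L))"
  proof -
    have "\<beta> y \<in> \<phi> ` L" if "y \<in> \<phi> ` L" for y
      using that L.twist_closed by (auto simp flip: twist)
    then show ?thesis
      unfolding even_linear_map_def
      using image_subset M.subspace_add[OF subspace_image] M.subspace_scale[OF subspace_image]
        M.twist_add M.twist_scale M.twist_homogeneous
      by (simp add: subset_iff)
  qed
  show "brM x y = - scaleM (super_sign i j) (brM y x)"
    if "x \<in> \<phi> ` L \<inter> GM i" "y \<in> \<phi> ` L \<inter> GM j" for x y i j
    using that M.super_skew_symmetric by blast
  show "scaleM (super_sign i k) (brM (restrict \<beta> (\<phi> ` L) x) (brM y z))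
      + scaleM (super_sign k j) (brM (restrict \<beta> (\<phi> ` L) z) (brM x y))
      + scaleM (super_sign j i) (brM (restrict \<beta> (\<phi> ` L) y) (brM z x)) = 0"
    if "x \<in> \<phi> ` L \<inter> GM i" "y \<in> \<phi> ` L \<inter> GM j" "z \<in> \<phi> ` L \<inter> GM k" for x y z i j k
    using that M.hom_super_jacobi[of x i y j z k] by simp
qed

end

section \<open>Transport of multiplicativity and of the p-map axioms\<close>

theorem theorem8:
  fixes scaleL :: "'f::field \<Rightarrow> 'v::ab_group_add \<Rightarrow> 'v"
    and L :: "'v set" and GL :: "bit \<Rightarrow> 'v set"
    and brL :: "'v \<Rightarrow> 'v \<Rightarrow> 'v" and \<alpha> :: "'v \<Rightarrow> 'v" and pmap :: "'v \<Rightarrow> 'v"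
    and scaleM :: "'f \<Rightarrow> 'w::ab_group_add \<Rightarrow> 'w"
    and M :: "'w set" and GM :: "bit \<Rightarrow> 'w set"
    and brM :: "'w \<Rightarrow> 'w \<Rightarrow> 'w" and \<beta> :: "'w \<Rightarrow> 'w"
    and \<phi> :: "'v \<Rightarrow> 'w"
  assumes "CHAR('f) > 0" and "CHAR('f) \<noteq> 2" and "CHAR('f) \<noteq> 3"
    and "restricted_hom_lie_superalgebra scaleL L GL brL \<alpha> pmap"
    and "multiplicative_hom_lie_superalgebra scaleM M GM brM \<beta>"
    and "hom_lie_superalgebra_morphism scaleL L GL brL \<alpha> scaleM M GM brM \<beta> \<phi>"
    and "inj_on \<phi> L"
  defines "G' \<equiv> (\<lambda>j. \<phi> ` L \<inter> GM j)"
    and "\<beta>' \<equiv> restrict \<beta> (\<phi> ` L)"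
  defines "pmap' \<equiv> image_pmap L \<phi> pmap (even_fixed G' \<beta>')"
  shows "\<phi> ` even_fixed GL \<alpha> = even_fixed G' \<beta>'
       \<and> (\<forall>x\<in>even_fixed GL \<alpha>. pmap' (\<phi> x) = \<phi> (pmap x))
       \<and> restricted_hom_lie_superalgebra scaleM (\<phi> ` L) G' brM \<beta>' pmap'"
proof -
  interpret L: restricted_hom_lie_superalgebra scaleL L GL brL \<alpha> pmap
    by fact
  interpret morph: hom_lie_superalgebra_morphism scaleL L GL brL \<alpha> scaleM M GM brM \<beta> \<phi>
    by fact
  interpret image: hom_lie_superalgebra scaleM "\<phi> ` L" G' brM \<beta>'
    unfolding G'_def \<beta>'_def by (rule morph.image_hom_lie_superalgebra) fact
  note inj = \<open>inj_on \<phi> L\<close>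
  note beta = morph.restricted_twist[folded \<beta>'_def]
  have fixed: "\<phi> ` even_fixed GL \<alpha> = even_fixed G' \<beta>'"
    unfolding G'_def \<beta>'_def by (rule morph.image_even_fixed) fact
  have fixedL: "x \<in> L" if "x \<in> even_fixed GL \<alpha>" for x
    using that L.even_fixed_subset_carrier by blast
  \<comment> \<open>Injectivity makes \<open>the_inv_into\<close> return x itself, and
    \<open>fixed\<close> puts \<phi>(x) inside the domain to which \<open>image_pmap\<close> is
    restricted.\<close>
  have pmap': "pmap' (\<phi> x) = \<phi> (pmap x)" if x: "x \<in> even_fixed GL \<alpha>" for x
    using x fixed the_inv_into_f_f[OF inj fixedL]
    by (auto simp: pmap'_def image_pmap_def)
  have "restricted_hom_lie_superalgebra scaleM (\<phi> ` L) G' brM \<beta>' pmap'"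
  \<comment> \<open>Rewriting the even fixed points of the image as images of those of L lets each
    axiom be checked on preimages.\<close>
  proof (unfold_locales, unfold fixed[symmetric])
    show "\<beta>' (brM x y) = brM (\<beta>' x) (\<beta>' y)" if xy: "x \<in> \<phi> ` L" "y \<in> \<phi> ` L" for x y
    proof -
      obtain u v where uv: "x = \<phi> u" "y = \<phi> v" "u \<in> L" "v \<in> L"
        using xy by blast
      then show ?thesis
        using beta[OF L.bracket_closed[OF uv(3,4)]]
        by (simp add: beta morph.bracket L.bracket_closed L.twist_closed L.multiplicative)
    qed
    show "pmap' x \<in> \<phi> ` even_fixed GL \<alpha>" if "x \<in> \<phi> ` even_fixed GL \<alpha>" for x
      using that L.pmap_closed by (auto simp: pmap')
    show "(ad_twist brM \<beta>' x ^^ CHAR('f)) b = ad_twist brM \<beta>' (pmap' x) b"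
      if xb: "x \<in> \<phi> ` even_fixed GL \<alpha>" "b \<in> \<phi> ` L" for x b
    proof -
      obtain u v where uv: "x = \<phi> u" "b = \<phi> v" "u \<in> even_fixed GL \<alpha>" "v \<in> L"
        using xb by blast
      have "(ad_twist brM \<beta>' x ^^ CHAR('f)) b = \<phi> ((ad_twist brL \<alpha> u ^^ CHAR('f)) v)"
        using uv fixedL by (simp add: morph.map_ad_twist_funpow \<beta>'_def)
      also have "\<dots> = \<phi> (ad_twist brL \<alpha> (pmap u) v)"
        using uv by (simp add: L.pmap_ad)
      also have "\<dots> = ad_twist brM \<beta>' (pmap' x) b"
        \<comment> \<open>Exponent 1 turns the statement on powers into the one on a single adjoint
          map.\<close>
        using uv fixedL L.pmap_closed morph.map_ad_twist_funpow(1)[of "pmap u" v 1]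
        by (simp add: pmap' \<beta>'_def)
      finally show ?thesis .
    qed
    show "pmap' (scaleM k x) = scaleM (k ^ CHAR('f)) (pmap' x)"
      if x: "x \<in> \<phi> ` even_fixed GL \<alpha>" for x k
    proof -
      obtain u where u: "x = \<phi> u" "u \<in> even_fixed GL \<alpha>"
        using x by blast
      have "pmap' (scaleM k x) = \<phi> (pmap (scaleL k u))"
        \<comment> \<open>The scaling law of \<phi> is read backwards, so that the argument becomes
          \<phi> of an even fixed point and \<open>pmap'\<close> can be evaluated.\<close>
        using u fixedL by (simp add: L.even_fixed_scale pmap' flip: morph.map_scale)
      then show ?thesis
        using u fixedL L.pmap_closed by (simp add: L.pmap_scale pmap' morph.map_scale)
    qed
    show "pmap' (x + y) = pmap' x + pmap' y
        + (\<Sum>i = 1..CHAR('f) - 1. jacobson_term scaleM brM \<beta>' i x y)"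
      if xy: "x \<in> \<phi> ` even_fixed GL \<alpha>" "y \<in> \<phi> ` even_fixed GL \<alpha>" for x y
    proof -
      obtain u v where uv: "x = \<phi> u" "y = \<phi> v" "u \<in> even_fixed GL \<alpha>" "v \<in> even_fixed GL \<alpha>"
        using xy by blast
      have uvL: "u \<in> L" "v \<in> L" "pmap u \<in> L" "pmap v \<in> L"
        using uv L.pmap_closed fixedL by blast+
      let ?J = "\<lambda>i. jacobson_term scaleL brL \<alpha> i u v"
      have J: "?J i \<in> L" for i
        using inj uvL(1,2) by (rule morph.jacobson_term_closed)
      have "pmap' (x + y) = \<phi> (pmap (u + v))"
        using uv uvL by (simp add: L.even_fixed_add pmap' flip: morph.map_add)
      also have "\<dots> = \<phi> (pmap u + pmap v + (\<Sum>i = 1..CHAR('f) - 1. ?J i))"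
        using uv by (simp add: L.pmap_add)
      also have "\<dots> = \<phi> (pmap u) + \<phi> (pmap v) + (\<Sum>i = 1..CHAR('f) - 1. \<phi> (?J i))"
        using uvL J L.subspace_add[OF L.subspace_carrier]
        by (simp add: morph.map_add morph.map_sum L.subspace_sum[OF L.subspace_carrier])
      finally show ?thesis
        using uv by (simp add: pmap' morph.map_jacobson_term[OF inj uvL(1,2)] \<beta>'_def)
    qed
  qed
  with fixed pmap' show ?thesis
    by blast
qed

end
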